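(* Let $(T,\mu,\eta)$ be an ordered saturation monad on $\mathsf{Set}$ such that arbitrary cotupling in $\mathcal{K}l(T)$ is monotonic and $T$ weakly lax preserves pullbacks, and assume the category of $T$-coalgebras has a final object $\zeta:Z\to TZ$. For a coalgebra $\beta:Y\to TY$ let $\mathsf{beh}_\beta:Y\to Z$ be the unique coalgebra homomorphism to $\zeta$. Then for every $\alpha:X\to TX$ and $x,y\in X$: $x\approx_*y$ if and only if $\mathsf{beh}_{\zeta^*}(\mathsf{beh}_\alpha(x))=\mathsf{beh}_{\zeta^*}(\mathsf{beh}_\alpha(y))$, where $\approx_*$ is the greatest weak bisimulation on $\alpha$.
   Context: Kleisli category $\mathcal{K}l(T)$: morphisms $X\rightsquigarrow Y$ are maps $X\to TY$, composition $g\cdot f=\mu_Z\circ Tg\circ f$, identity $1_X=\eta_X$; $f^\sharp=\eta_Y\circ f$. A homomorphism of $T$-coalgebras $\alpha\to\beta$ is a map $h$ with $Th\circ\alpha=\beta\circ h$. Ordered saturation monad: $\mathcal{K}l(T)$ order enriched and for each $\alpha:X\rightsquigarrow X$ there is $\alpha^*$ with (1) $1\le\alpha^*$; (2) $\alpha\le\alpha^*$; (3) $\alpha^*\cdot\alpha^*\le\alpha^*$; (4) $\alpha^*\le\beta$ whenever $1\le\beta$, $\alpha\le\beta$, $\beta\cdot\beta\le\beta$; (5) for any map $f:X\to Y$ and $\beta:Y\rightsquigarrow Y$, $f^\sharp\cdot\alpha\le\beta\cdot f^\sharp\Rightarrow f^\sharp\cdot\alpha^*\le\beta^*\cdot f^\sharp$,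 and likewise with $\ge$. Weak bisimulation on $\alpha$: symmetric $R\subseteq X\times X$ with some $\gamma:R\to TR$ such that $\alpha\cdot\pi_1^\sharp\le\pi_1^\sharp\cdot\gamma$ and $\pi_2^\sharp\cdot\gamma\le\alpha^*\cdot\pi_2^\sharp$. Cotupling monotonic: $f_i\le g_i$ for all $i$ implies $[\{f_i\}]\le[\{g_i\}]$ in $\mathcal{K}l(T)$. Weakly lax preserving pullbacks: for every pullback $P$ (projections $p_1,p_2$) of $A\xrightarrow{f}C\xleftarrow{g}B$, the $T$-image square is a weak pullback and for any $q_1:W\to TA$, $q_2:W\to TB$ with $Tf\circ q_1\le Tg\circ q_2$ there is $\xi:W\to TP$ with $q_1\le Tp_1\circ\xi$ and $Tp_2\circ\xi\le q_2$. *)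

theory Defs
  imports Main "HOL-Library.FuncSet" "HOL-Library.Nat_Bijection"
begin

text \<open>
  The category \<open>Set\<close> is the category of small sets of an arbitrary Grothendieck universe, given
  without material membership: small sets are certain subsets of a type \<^typ>\<open>'u\<close>, and since
  \<open>Pow A\<close> and \<open>A \<times> B\<close> do not live in \<^typ>\<open>'u set\<close>, they are present up to a bijection; for
  products this bijection is an injective pairing function. The morphisms \<open>X \<rightarrow> Y\<close>
  are the extensional functions \<open>X \<rightarrow>\<^sub>E Y\<close>, composed by \<^const>\<open>compose\<close>, so that
  equality of morphisms is equality in HOL. As in SGA 4, a universe need not contain an infinite
  set; every universe that does is an instance.
\<close>

locale set_universe =
  fixes U :: "'u set set" and pr :: "'u \<Rightarrow> 'u \<Rightarrow> 'u"
  assumes small_subset: "A \<in> U \<Longrightarrow> B \<subseteq> A \<Longrightarrow> B \<in> U"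
    and small_doubleton: "{a, b} \<in> U"
    and small_UN: "A \<in> U \<Longrightarrow> (\<And>a. a \<in> A \<Longrightarrow> F a \<in> U) \<Longrightarrow> (\<Union>a\<in>A. F a) \<in> U"
    and small_Pow: "A \<in> U \<Longrightarrow> \<exists>B\<in>U. \<exists>f. bij_betw f B (Pow A)"
    and pr_inject: "pr a b = pr c d \<longleftrightarrow> a = c \<and> b = d"

definition pfst :: "('u \<Rightarrow> 'u \<Rightarrow> 'u) \<Rightarrow> 'u \<Rightarrow> 'u" where
  "pfst pr p = (THE a. \<exists>b. p = pr a b)"

definition psnd :: "('u \<Rightarrow> 'u \<Rightarrow> 'u) \<Rightarrow> 'u \<Rightarrow> 'u" where
  "psnd pr p = (THE b. \<exists>a. p = pr a b)"

lemma (in set_universe) pfst_pr [simp]: "pfst pr (pr a b) = a"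
  and psnd_pr [simp]: "psnd pr (pr a b) = b"
  by (auto simp: pfst_def psnd_def pr_inject)

lemma (in set_universe) small_product:
  assumes "A \<in> U" "\<And>a. a \<in> A \<Longrightarrow> B a \<in> U"
  shows "(\<lambda>(a, b). pr a b) ` (SIGMA a:A. B a) \<in> U"
proof -
  have "{pr a b} \<in> U" for a b
    using small_doubleton[of "pr a b" "pr a b"] by simp
  then have "(\<Union>a\<in>A. \<Union>b\<in>B a. {pr a b}) \<in> U"
    by (intro small_UN assms) auto
  moreover have "(\<lambda>(a, b). pr a b) ` (SIGMA a:A. B a) = (\<Union>a\<in>A. \<Union>b\<in>B a. {pr a b})"
    by auto
  ultimately show ?thesis by simp
qed

text \<open>The axioms are satisfiable in HOL: the finite sets of natural numbers form a universe.\<close>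

lemma set_universe_finite_nat:
  "set_universe (Collect finite :: nat set set) (\<lambda>a b. prod_encode (a, b))"
proof
  fix A :: "nat set" assume "A \<in> Collect finite"
  then have "finite (Pow A)" by simp
  then obtain f where "bij_betw f {0..<card (Pow A)} (Pow A)"
    using ex_bij_betw_nat_finite by blast
  then show "\<exists>B\<in>Collect finite :: nat set set. \<exists>f. bij_betw f B (Pow A)"
    by (metis finite_atLeastLessThan mem_Collect_eq)
qed (auto intro: finite_subset)

definition is_weak_pullback ::
  "'u set set \<Rightarrow> 'u set \<Rightarrow> 'u set \<Rightarrow> 'u set \<Rightarrow> ('u \<Rightarrow> 'u) \<Rightarrow> ('u \<Rightarrow> 'u) \<Rightarrow>
   'u set \<Rightarrow> ('u \<Rightarrow> 'u) \<Rightarrow> ('u \<Rightarrow> 'u) \<Rightarrow> bool" where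
  "is_weak_pullback U A B C f g P p1 p2 \<longleftrightarrow>
     P \<in> U \<and> p1 \<in> P \<rightarrow>\<^sub>E A \<and> p2 \<in> P \<rightarrow>\<^sub>E B \<and> compose P f p1 = compose P g p2 \<and>
     (\<forall>W\<in>U. \<forall>q1\<in>W \<rightarrow>\<^sub>E A. \<forall>q2\<in>W \<rightarrow>\<^sub>E B. compose W f q1 = compose W g q2 \<longrightarrow>
        (\<exists>u\<in>W \<rightarrow>\<^sub>E P. compose W p1 u = q1 \<and> compose W p2 u = q2))"

definition is_pullback ::
  "'u set set \<Rightarrow> 'u set \<Rightarrow> 'u set \<Rightarrow> 'u set \<Rightarrow> ('u \<Rightarrow> 'u) \<Rightarrow> ('u \<Rightarrow> 'u) \<Rightarrow>
   'u set \<Rightarrow> ('u \<Rightarrow> 'u) \<Rightarrow> ('u \<Rightarrow> 'u) \<Rightarrow> bool" where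
  "is_pullback U A B C f g P p1 p2 \<longleftrightarrow>
     P \<in> U \<and> p1 \<in> P \<rightarrow>\<^sub>E A \<and> p2 \<in> P \<rightarrow>\<^sub>E B \<and> compose P f p1 = compose P g p2 \<and>
     (\<forall>W\<in>U. \<forall>q1\<in>W \<rightarrow>\<^sub>E A. \<forall>q2\<in>W \<rightarrow>\<^sub>E B. compose W f q1 = compose W g q2 \<longrightarrow>
        (\<exists>!u. u \<in> W \<rightarrow>\<^sub>E P \<and> compose W p1 u = q1 \<and> compose W p2 u = q2))"

text \<open>
  \<open>Tmap T X Y f\<close> is \<open>Tf\<close> for \<open>f : X \<rightarrow> Y\<close>; \<open>kle T X Y\<close> is the order on the Kleisli morphisms
  \<open>X \<leadsto> Y\<close>; \<open>sat T X \<alpha>\<close> is \<open>\<alpha>\<^sup>*\<close> for \<open>\<alpha> : X \<leadsto> X\<close>. Values on arguments that are not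
  small sets or not morphisms are irrelevant.
\<close>

record 'u monad_data =
  Tob :: "'u set \<Rightarrow> 'u set"
  Tmap :: "'u set \<Rightarrow> 'u set \<Rightarrow> ('u \<Rightarrow> 'u) \<Rightarrow> 'u \<Rightarrow> 'u"
  eta :: "'u set \<Rightarrow> 'u \<Rightarrow> 'u"
  mu :: "'u set \<Rightarrow> 'u \<Rightarrow> 'u"

record 'u saturation_data = "'u monad_data" +
  kle :: "'u set \<Rightarrow> 'u set \<Rightarrow> ('u \<Rightarrow> 'u) \<Rightarrow> ('u \<Rightarrow> 'u) \<Rightarrow> bool"
  sat :: "'u set \<Rightarrow> ('u \<Rightarrow> 'u) \<Rightarrow> 'u \<Rightarrow> 'u"

locale set_monad =
  fixes U :: "'u set set" and T :: "('u, 'm) monad_data_scheme"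
  assumes Tob_small: "X \<in> U \<Longrightarrow> Tob T X \<in> U"
    and Tmap_hom: "\<lbrakk>X \<in> U; Y \<in> U; f \<in> X \<rightarrow>\<^sub>E Y\<rbrakk> \<Longrightarrow> Tmap T X Y f \<in> Tob T X \<rightarrow>\<^sub>E Tob T Y"
    and Tmap_id: "X \<in> U \<Longrightarrow> Tmap T X X (\<lambda>x\<in>X. x) = (\<lambda>t\<in>Tob T X. t)"
    and Tmap_compose: "\<lbrakk>X \<in> U; Y \<in> U; Z \<in> U; f \<in> X \<rightarrow>\<^sub>E Y; g \<in> Y \<rightarrow>\<^sub>E Z\<rbrakk> \<Longrightarrow>
      Tmap T X Z (compose X g f) = compose (Tob T X) (Tmap T Y Z g) (Tmap T X Y f)"
    and eta_hom: "X \<in> U \<Longrightarrow> eta T X \<in> X \<rightarrow>\<^sub>E Tob T X"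
    and eta_natural: "\<lbrakk>X \<in> U; Y \<in> U; f \<in> X \<rightarrow>\<^sub>E Y\<rbrakk> \<Longrightarrow>
      compose X (Tmap T X Y f) (eta T X) = compose X (eta T Y) f"
    and mu_hom: "X \<in> U \<Longrightarrow> mu T X \<in> Tob T (Tob T X) \<rightarrow>\<^sub>E Tob T X"
    and mu_natural: "\<lbrakk>X \<in> U; Y \<in> U; f \<in> X \<rightarrow>\<^sub>E Y\<rbrakk> \<Longrightarrow>
      compose (Tob T (Tob T X)) (Tmap T X Y f) (mu T X) =
      compose (Tob T (Tob T X)) (mu T Y) (Tmap T (Tob T X) (Tob T Y) (Tmap T X Y f))"
    and mu_eta: "X \<in> U \<Longrightarrow> compose (Tob T X) (mu T X) (eta T (Tob T X)) = (\<lambda>t\<in>Tob T X. t)"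
    and mu_Tmap_eta: "X \<in> U \<Longrightarrow>
      compose (Tob T X) (mu T X) (Tmap T X (Tob T X) (eta T X)) = (\<lambda>t\<in>Tob T X. t)"
    and mu_assoc: "X \<in> U \<Longrightarrow>
      compose (Tob T (Tob T (Tob T X))) (mu T X) (mu T (Tob T X)) =
      compose (Tob T (Tob T (Tob T X))) (mu T X) (Tmap T (Tob T (Tob T X)) (Tob T X) (mu T X))"

definition Kl :: "('u, 'm) monad_data_scheme \<Rightarrow> 'u set \<Rightarrow> 'u set \<Rightarrow> ('u \<Rightarrow> 'u) set" where
  "Kl T X Y = X \<rightarrow>\<^sub>E Tob T Y"

text \<open>\<open>kcomp T X Y Z g f\<close> is \<open>g \<cdot> f\<close> for \<open>f : X \<leadsto> Y\<close> and \<open>g : Y \<leadsto> Z\<close>.\<close>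

definition kcomp ::
  "('u, 'm) monad_data_scheme \<Rightarrow> 'u set \<Rightarrow> 'u set \<Rightarrow> 'u set \<Rightarrow> ('u \<Rightarrow> 'u) \<Rightarrow> ('u \<Rightarrow> 'u) \<Rightarrow> 'u \<Rightarrow> 'u"
  where "kcomp T X Y Z g f = compose X (mu T Z) (compose X (Tmap T Y (Tob T Z) g) f)"

definition sharp :: "('u, 'm) monad_data_scheme \<Rightarrow> 'u set \<Rightarrow> 'u set \<Rightarrow> ('u \<Rightarrow> 'u) \<Rightarrow> 'u \<Rightarrow> 'u" where
  "sharp T X Y f = compose X (eta T Y) f"

locale ordered_monad = set_monad U T
  for U :: "'u set set" and T :: "('u, 'm) saturation_data_scheme" +
  assumes kle_order: "\<lbrakk>X \<in> U; Y \<in> U\<rbrakk> \<Longrightarrow>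
      partial_order_on (Kl T X Y) (relation_of (kle T X Y) (Kl T X Y))"
    and kcomp_mono: "\<lbrakk>X \<in> U; Y \<in> U; Z \<in> U;
        f \<in> Kl T X Y; f' \<in> Kl T X Y; g \<in> Kl T Y Z; g' \<in> Kl T Y Z;
        kle T X Y f f'; kle T Y Z g g'\<rbrakk> \<Longrightarrow>
      kle T X Z (kcomp T X Y Z g f) (kcomp T X Y Z g' f')"

locale ordered_saturation_monad = ordered_monad U T
  for U :: "'u set set" and T :: "('u, 'm) saturation_data_scheme" +
  assumes sat_hom: "\<lbrakk>X \<in> U; \<alpha> \<in> Kl T X X\<rbrakk> \<Longrightarrow> sat T X \<alpha> \<in> Kl T X X"
    and sat_refl: "\<lbrakk>X \<in> U; \<alpha> \<in> Kl T X X\<rbrakk> \<Longrightarrow> kle T X X (eta T X) (sat T X \<alpha>)"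
    and sat_incl: "\<lbrakk>X \<in> U; \<alpha> \<in> Kl T X X\<rbrakk> \<Longrightarrow> kle T X X \<alpha> (sat T X \<alpha>)"
    and sat_trans: "\<lbrakk>X \<in> U; \<alpha> \<in> Kl T X X\<rbrakk> \<Longrightarrow>
      kle T X X (kcomp T X X X (sat T X \<alpha>) (sat T X \<alpha>)) (sat T X \<alpha>)"
    and sat_least: "\<lbrakk>X \<in> U; \<alpha> \<in> Kl T X X; \<beta> \<in> Kl T X X;
        kle T X X (eta T X) \<beta>; kle T X X \<alpha> \<beta>; kle T X X (kcomp T X X X \<beta> \<beta>) \<beta>\<rbrakk> \<Longrightarrow>
      kle T X X (sat T X \<alpha>) \<beta>"
    and sat_lax: "\<lbrakk>X \<in> U; Y \<in> U; f \<in> X \<rightarrow>\<^sub>E Y; \<alpha> \<in> Kl T X X; \<beta> \<in> Kl T Y Y;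
        kle T X Y (kcomp T X X Y (sharp T X Y f) \<alpha>) (kcomp T X Y Y \<beta> (sharp T X Y f))\<rbrakk> \<Longrightarrow>
      kle T X Y (kcomp T X X Y (sharp T X Y f) (sat T X \<alpha>))
        (kcomp T X Y Y (sat T Y \<beta>) (sharp T X Y f))"
    and sat_oplax: "\<lbrakk>X \<in> U; Y \<in> U; f \<in> X \<rightarrow>\<^sub>E Y; \<alpha> \<in> Kl T X X; \<beta> \<in> Kl T Y Y;
        kle T X Y (kcomp T X Y Y \<beta> (sharp T X Y f)) (kcomp T X X Y (sharp T X Y f) \<alpha>)\<rbrakk> \<Longrightarrow>
      kle T X Y (kcomp T X Y Y (sat T Y \<beta>) (sharp T X Y f))
        (kcomp T X X Y (sharp T X Y f) (sat T X \<alpha>))"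

text \<open>
  Coproducts in the Kleisli category are those of \<open>Set\<close>, with coprojections \<open>in\<^sub>i\<^sup>\<sharp>\<close>, and the
  cotuple in \<open>Kl T\<close> of \<open>f\<^sub>i : X\<^sub>i \<leadsto> Y\<close> is the cotuple of the maps \<open>f\<^sub>i : X\<^sub>i \<rightarrow> TY\<close>.
\<close>

definition coproduct :: "('u \<Rightarrow> 'u \<Rightarrow> 'u) \<Rightarrow> 'u set \<Rightarrow> ('u \<Rightarrow> 'u set) \<Rightarrow> 'u set" where
  "coproduct pr I X = (\<lambda>(i, x). pr i x) ` (SIGMA i:I. X i)"

definition cotuple ::
  "('u \<Rightarrow> 'u \<Rightarrow> 'u) \<Rightarrow> 'u set \<Rightarrow> ('u \<Rightarrow> 'u set) \<Rightarrow> ('u \<Rightarrow> 'u \<Rightarrow> 'u) \<Rightarrow> 'u \<Rightarrow> 'u" where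
  "cotuple pr I X f = (\<lambda>p\<in>coproduct pr I X. f (pfst pr p) (psnd pr p))"

definition cotupling_monotonic ::
  "'u set set \<Rightarrow> ('u \<Rightarrow> 'u \<Rightarrow> 'u) \<Rightarrow> ('u, 'm) saturation_data_scheme \<Rightarrow> bool" where
  "cotupling_monotonic U pr T \<longleftrightarrow>
     (\<forall>I\<in>U. \<forall>X Y f g. (\<forall>i\<in>I. X i \<in> U) \<longrightarrow> Y \<in> U \<longrightarrow>
        (\<forall>i\<in>I. f i \<in> Kl T (X i) Y \<and> g i \<in> Kl T (X i) Y \<and> kle T (X i) Y (f i) (g i)) \<longrightarrow>
        kle T (coproduct pr I X) Y (cotuple pr I X f) (cotuple pr I X g))"

definition weakly_lax_preserves_pullbacks ::
  "'u set set \<Rightarrow> ('u, 'm) saturation_data_scheme \<Rightarrow> bool" where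
  "weakly_lax_preserves_pullbacks U T \<longleftrightarrow>
     (\<forall>A\<in>U. \<forall>B\<in>U. \<forall>C\<in>U. \<forall>f\<in>A \<rightarrow>\<^sub>E C. \<forall>g\<in>B \<rightarrow>\<^sub>E C. \<forall>P p1 p2. is_pullback U A B C f g P p1 p2 \<longrightarrow>
        is_weak_pullback U (Tob T A) (Tob T B) (Tob T C) (Tmap T A C f) (Tmap T B C g)
          (Tob T P) (Tmap T P A p1) (Tmap T P B p2) \<and>
        (\<forall>W\<in>U. \<forall>q1\<in>W \<rightarrow>\<^sub>E Tob T A. \<forall>q2\<in>W \<rightarrow>\<^sub>E Tob T B.
           kle T W C (compose W (Tmap T A C f) q1) (compose W (Tmap T B C g) q2) \<longrightarrow>
           (\<exists>\<xi>\<in>W \<rightarrow>\<^sub>E Tob T P. kle T W A q1 (compose W (Tmap T P A p1) \<xi>) \<and>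
                             kle T W B (compose W (Tmap T P B p2) \<xi>) q2)))"

definition coalg_hom ::
  "('u, 'm) monad_data_scheme \<Rightarrow> 'u set \<Rightarrow> ('u \<Rightarrow> 'u) \<Rightarrow> 'u set \<Rightarrow> ('u \<Rightarrow> 'u) \<Rightarrow> ('u \<Rightarrow> 'u) \<Rightarrow> bool" where
  "coalg_hom T X \<alpha> Y \<beta> h \<longleftrightarrow> h \<in> X \<rightarrow>\<^sub>E Y \<and> compose X (Tmap T X Y h) \<alpha> = compose X \<beta> h"

definition final_coalgebra ::
  "'u set set \<Rightarrow> ('u, 'm) monad_data_scheme \<Rightarrow> 'u set \<Rightarrow> ('u \<Rightarrow> 'u) \<Rightarrow> bool" where
  "final_coalgebra U T Z \<zeta> \<longleftrightarrow> Z \<in> U \<and> \<zeta> \<in> Z \<rightarrow>\<^sub>E Tob T Z \<and>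
     (\<forall>Y\<in>U. \<forall>\<beta>\<in>Y \<rightarrow>\<^sub>E Tob T Y. \<exists>!h. coalg_hom T Y \<beta> Z \<zeta> h)"

definition beh ::
  "('u, 'm) monad_data_scheme \<Rightarrow> 'u set \<Rightarrow> ('u \<Rightarrow> 'u) \<Rightarrow> 'u set \<Rightarrow> ('u \<Rightarrow> 'u) \<Rightarrow> 'u \<Rightarrow> 'u" where
  "beh T Z \<zeta> Y \<beta> = (THE h. coalg_hom T Y \<beta> Z \<zeta> h)"

text \<open>The relation \<open>R \<subseteq> X \<times> X\<close> is turned into an object of \<open>Set\<close> by the pairing function.\<close>

definition rel_ob :: "('u \<Rightarrow> 'u \<Rightarrow> 'u) \<Rightarrow> ('u \<times> 'u) set \<Rightarrow> 'u set" where
  "rel_ob pr R = (\<lambda>(x, y). pr x y) ` R"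

definition weak_bisimulation ::
  "('u \<Rightarrow> 'u \<Rightarrow> 'u) \<Rightarrow> ('u, 'm) saturation_data_scheme \<Rightarrow> 'u set \<Rightarrow> ('u \<Rightarrow> 'u) \<Rightarrow> ('u \<times> 'u) set \<Rightarrow> bool"
  where
  "weak_bisimulation pr T X \<alpha> R \<longleftrightarrow> R \<subseteq> X \<times> X \<and> sym R \<and>
     (let P = rel_ob pr R;
          \<pi>1 = sharp T P X (\<lambda>p\<in>P. pfst pr p);
          \<pi>2 = sharp T P X (\<lambda>p\<in>P. psnd pr p)
      in \<exists>\<gamma>\<in>P \<rightarrow>\<^sub>E Tob T P.
           kle T P X (kcomp T P X X \<alpha> \<pi>1) (kcomp T P P X \<pi>1 \<gamma>) \<and>
           kle T P X (kcomp T P P X \<pi>2 \<gamma>) (kcomp T P X X (sat T X \<alpha>) \<pi>2))"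

definition weak_bisimilarity ::
  "('u \<Rightarrow> 'u \<Rightarrow> 'u) \<Rightarrow> ('u, 'm) saturation_data_scheme \<Rightarrow> 'u set \<Rightarrow> ('u \<Rightarrow> 'u) \<Rightarrow> ('u \<times> 'u) set" where
  "weak_bisimilarity pr T X \<alpha> = (GREATEST R. weak_bisimulation pr T X \<alpha> R)"

end

theory Submission
  imports Defs
begin

text \<open>
  Saturation turns homomorphisms \<open>\<alpha> \<rightarrow> \<beta>\<close> into homomorphisms \<open>\<alpha>\<^sup>* \<rightarrow> \<beta>\<^sup>*\<close>, so
  \<open>beh\<^bsub>\<zeta>*\<^esub> \<circ> beh\<^bsub>\<alpha>\<^esub>\<close> is the unique homomorphism \<open>k : \<alpha>\<^sup>* \<rightarrow> \<zeta>\<close>, and it is enough to see that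
  the kernel of \<open>k\<close> is the greatest weak bisimulation. It is a weak bisimulation because \<open>T\<close>
  weakly preserves the kernel pair of \<open>k\<close>. Conversely, let \<open>R\<close> be a weak bisimulation witnessed
  by \<open>\<gamma>\<close>, and let \<open>q\<close> be the quotient map of the equivalence relation generated by \<open>R\<close>. Saturating
  \<open>\<gamma>\<close> gives \<open>Tq \<circ> \<alpha>\<^sup>* \<circ> \<pi>\<^sub>1 \<le> Tq \<circ> \<alpha>\<^sup>* \<circ> \<pi>\<^sub>2\<close>; symmetry of \<open>R\<close> makes this an equality, so the
  quotient carries a coalgebra structure for which \<open>q\<close> is a homomorphism from \<open>\<alpha>\<^sup>*\<close>. By finality
  \<open>k\<close> factors through \<open>q\<close>.
\<close>

section \<open>Composition of extensional functions\<close>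

lemma compose_PiE: "f \<in> A \<rightarrow>\<^sub>E B \<Longrightarrow> g \<in> B \<rightarrow>\<^sub>E C \<Longrightarrow> compose A g f \<in> A \<rightarrow>\<^sub>E C"
  by (auto simp: compose_def)

lemma compose_assoc_PiE:
  "f \<in> A \<rightarrow>\<^sub>E B \<Longrightarrow> compose A h (compose A g f) = compose A (compose B h g) f"
  by (auto simp: compose_def fun_eq_iff)

section \<open>Kleisli composites with maps, and homomorphisms into the final coalgebra\<close>

context set_monad
begin

text \<open>Functoriality splits \<open>T(\<eta> \<circ> f)\<close>, and the unit law
  \<open>mu_Tmap_eta\<close> cancels \<open>\<mu> \<circ> T\<eta>\<close>.\<close>

lemma kcomp_sharp_left:
  assumes "W \<in> U" "X \<in> U" "Y \<in> U" "f \<in> X \<rightarrow>\<^sub>E Y" "\<alpha> \<in> Kl T W X"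
  shows "kcomp T W X Y (sharp T X Y f) \<alpha> = compose W (Tmap T X Y f) \<alpha>"
proof
  fix w
  show "kcomp T W X Y (sharp T X Y f) \<alpha> w = compose W (Tmap T X Y f) \<alpha> w"
  proof (cases "w \<in> W")
    case True
    then have aw: "\<alpha> w \<in> Tob T X" using assms by (auto simp: Kl_def)
    then have fw: "Tmap T X Y f (\<alpha> w) \<in> Tob T Y"
      using Tmap_hom[OF assms(2,3,4)] by auto
    have "Tmap T X (Tob T Y) (compose X (eta T Y) f) =
        compose (Tob T X) (Tmap T Y (Tob T Y) (eta T Y)) (Tmap T X Y f)"
      using assms by (intro Tmap_compose Tob_small eta_hom)
    with True aw fw fun_cong[OF mu_Tmap_eta[OF assms(3)], of "Tmap T X Y f (\<alpha> w)"]
    show ?thesis by (simp add: kcomp_def sharp_def compose_def)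
  qed (simp add: kcomp_def compose_def)
qed

text \<open>Naturality of \<open>eta\<close> moves the unit past \<beta>, where
  \<open>mu_eta\<close> cancels it.\<close>

lemma kcomp_sharp_right:
  assumes "X \<in> U" "Y \<in> U" "Z \<in> U" "f \<in> X \<rightarrow>\<^sub>E Y" "\<beta> \<in> Kl T Y Z"
  shows "kcomp T X Y Z \<beta> (sharp T X Y f) = compose X \<beta> f"
proof
  fix x
  show "kcomp T X Y Z \<beta> (sharp T X Y f) x = compose X \<beta> f x"
  proof (cases "x \<in> X")
    case True
    then have fx: "f x \<in> Y" using assms by auto
    then have bx: "\<beta> (f x) \<in> Tob T Z" using assms by (auto simp: Kl_def)
    have "compose Y (Tmap T Y (Tob T Z) \<beta>) (eta T Y) = compose Y (eta T (Tob T Z)) \<beta>"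
      using assms by (intro eta_natural Tob_small) (auto simp: Kl_def)
    from fun_cong[OF this, of "f x"] fun_cong[OF mu_eta[OF assms(3)], of "\<beta> (f x)"] True fx bx
    show ?thesis by (simp add: kcomp_def sharp_def compose_def)
  qed (simp add: kcomp_def compose_def)
qed

lemma coalg_hom_compose:
  assumes "X \<in> U" "Y \<in> U" "Z \<in> U" and \<alpha>: "\<alpha> \<in> X \<rightarrow>\<^sub>E Tob T X"
    and f: "coalg_hom T X \<alpha> Y \<beta> f" and g: "coalg_hom T Y \<beta> Z \<gamma> g"
  shows "coalg_hom T X \<alpha> Z \<gamma> (compose X g f)"
proof -
  have fY: "f \<in> X \<rightarrow>\<^sub>E Y" and gZ: "g \<in> Y \<rightarrow>\<^sub>E Z" using f g by (auto simp: coalg_hom_def)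
  have "compose X (Tmap T X Z (compose X g f)) \<alpha>
      = compose X (Tmap T Y Z g) (compose X (Tmap T X Y f) \<alpha>)"
    using assms(1-3) fY gZ \<alpha> by (simp add: Tmap_compose compose_assoc_PiE[OF \<alpha>])
  also have "\<dots> = compose X (compose Y (Tmap T Y Z g) \<beta>) f"
    using f fY by (simp add: coalg_hom_def compose_assoc_PiE)
  also have "\<dots> = compose X \<gamma> (compose X g f)"
    using g fY by (simp add: coalg_hom_def compose_assoc_PiE)
  finally show ?thesis using fY gZ by (simp add: coalg_hom_def compose_PiE)
qed

lemma coalg_hom_final_unique:
  assumes "final_coalgebra U T Z \<zeta>" "X \<in> U" "\<alpha> \<in> X \<rightarrow>\<^sub>E Tob T X"
    "coalg_hom T X \<alpha> Z \<zeta> g" "coalg_hom T X \<alpha> Z \<zeta> h"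
  shows "g = h"
  using assms unfolding final_coalgebra_def by blast

lemma coalg_hom_beh:
  assumes "final_coalgebra U T Z \<zeta>" "X \<in> U" "\<alpha> \<in> X \<rightarrow>\<^sub>E Tob T X"
  shows "coalg_hom T X \<alpha> Z \<zeta> (beh T Z \<zeta> X \<alpha>)"
proof -
  have "\<exists>!h. coalg_hom T X \<alpha> Z \<zeta> h" using assms by (simp add: final_coalgebra_def)
  then show ?thesis unfolding beh_def by (rule theI')
qed

text \<open>The quotient is realised by a set of representatives, with \<open>q\<close> picking the representative.\<close>

lemma coalg_hom_final_respects:
  assumes final: "final_coalgebra U T Z \<zeta>" and X: "X \<in> U" and \<alpha>: "\<alpha> \<in> X \<rightarrow>\<^sub>E Tob T X"
    and Q: "Q \<in> U" "Q \<subseteq> X" and q: "q \<in> X \<rightarrow>\<^sub>E Q"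
    and rep: "\<And>x. x \<in> X \<Longrightarrow> Tmap T X Q q (\<alpha> (q x)) = Tmap T X Q q (\<alpha> x)"
    and h: "coalg_hom T X \<alpha> Z \<zeta> h" and "x \<in> X" "y \<in> X" "q x = q y"
  shows "h x = h y"
proof -
  \<comment> \<open>Since \<open>Q\<close> is a subset of \<open>X\<close>, the structure at a class
    can be read off at its representative; \<open>rep\<close> then makes \<open>q\<close> a
    homomorphism to \<delta>.\<close>
  define \<delta> where "\<delta> = compose Q (Tmap T X Q q) \<alpha>"
  have "Tmap T X Q q \<in> Tob T X \<rightarrow>\<^sub>E Tob T Q" by (intro Tmap_hom X Q q)
  with \<alpha> Q(2) have \<delta>: "\<delta> \<in> Q \<rightarrow>\<^sub>E Tob T Q" by (auto simp: \<delta>_def compose_def)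
  have "coalg_hom T X \<alpha> Q \<delta> q"
    using q rep by (auto simp: coalg_hom_def \<delta>_def compose_def fun_eq_iff)
  moreover obtain b where "coalg_hom T Q \<delta> Z \<zeta> b" using coalg_hom_beh[OF final Q(1) \<delta>] by blast
  moreover have "Z \<in> U" using final by (simp add: final_coalgebra_def)
  ultimately have "coalg_hom T X \<alpha> Z \<zeta> (compose X b q)" using X Q \<alpha> coalg_hom_compose by blast
  then have "h = compose X b q" using coalg_hom_final_unique[OF final X \<alpha> h] by simp
  then show ?thesis using \<open>x \<in> X\<close> \<open>y \<in> X\<close> \<open>q x = q y\<close> by (simp add: compose_def)
qed

end

section \<open>The order on Kleisli morphisms\<close>

context ordered_monad
begin

lemma kle_refl: "X \<in> U \<Longrightarrow> Y \<in> U \<Longrightarrow> f \<in> Kl T X Y \<Longrightarrow> kle T X Y f f"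
  using kle_order[of X Y]
  by (auto simp: partial_order_on_def preorder_on_def refl_on_def relation_of_def)

lemma kle_trans:
  assumes "X \<in> U" "Y \<in> U" "f \<in> Kl T X Y" "g \<in> Kl T X Y" "h \<in> Kl T X Y"
    "kle T X Y f g" "kle T X Y g h"
  shows "kle T X Y f h"
proof -
  have "trans (relation_of (kle T X Y) (Kl T X Y))"
    using kle_order[OF assms(1,2)] by (simp add: partial_order_on_def preorder_on_def)
  then have "(f, h) \<in> relation_of (kle T X Y) (Kl T X Y)"
    by (rule transD[of _ f g h]) (use assms in \<open>auto simp: relation_of_def\<close>)
  then show ?thesis by (simp add: relation_of_def)
qed

lemma kle_antisym:
  assumes "X \<in> U" "Y \<in> U" "f \<in> Kl T X Y" "g \<in> Kl T X Y" "kle T X Y f g" "kle T X Y g f"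
  shows "f = g"
proof -
  have "antisym (relation_of (kle T X Y) (Kl T X Y))"
    using kle_order[OF assms(1,2)] by (simp add: partial_order_on_def)
  then show ?thesis
    by (rule antisymD) (use assms in \<open>auto simp: relation_of_def\<close>)
qed

lemma sharp_Kl: "Y \<in> U \<Longrightarrow> f \<in> X \<rightarrow>\<^sub>E Y \<Longrightarrow> sharp T X Y f \<in> Kl T X Y"
  unfolding sharp_def Kl_def by (rule compose_PiE[OF _ eta_hom])

text \<open>Precomposing with a map is Kleisli composition with its \<open>sharp\<close>, so this is
  an instance of \<open>kcomp_mono\<close>.\<close>

lemma kle_compose_right:
  assumes "X \<in> U" "Y \<in> U" "Z \<in> U" "f \<in> X \<rightarrow>\<^sub>E Y" "g \<in> Kl T Y Z" "g' \<in> Kl T Y Z"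
    "kle T Y Z g g'"
  shows "kle T X Z (compose X g f) (compose X g' f)"
  using kcomp_mono[of X Y Z "sharp T X Y f" "sharp T X Y f" g g'] assms
  by (simp add: kcomp_sharp_right sharp_Kl kle_refl)

lemma kle_Tmap_left:
  assumes "X \<in> U" "Y \<in> U" "Z \<in> U" "f \<in> Y \<rightarrow>\<^sub>E Z" "g \<in> Kl T X Y" "g' \<in> Kl T X Y"
    "kle T X Y g g'"
  shows "kle T X Z (compose X (Tmap T Y Z f) g) (compose X (Tmap T Y Z f) g')"
  using kcomp_mono[of X Y Z g g' "sharp T Y Z f" "sharp T Y Z f"] assms
  by (simp add: kcomp_sharp_left sharp_Kl kle_refl)

end

section \<open>Saturation of homomorphisms\<close>

context ordered_saturation_monad
begin

lemma sat_lax_Tmap: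
  assumes "X \<in> U" "Y \<in> U" "f \<in> X \<rightarrow>\<^sub>E Y" "\<alpha> \<in> Kl T X X" "\<beta> \<in> Kl T Y Y"
    "kle T X Y (compose X (Tmap T X Y f) \<alpha>) (compose X \<beta> f)"
  shows "kle T X Y (compose X (Tmap T X Y f) (sat T X \<alpha>)) (compose X (sat T Y \<beta>) f)"
  using sat_lax[of X Y f \<alpha> \<beta>] assms
  by (simp add: kcomp_sharp_left kcomp_sharp_right sat_hom)

lemma sat_oplax_Tmap:
  assumes "X \<in> U" "Y \<in> U" "f \<in> X \<rightarrow>\<^sub>E Y" "\<alpha> \<in> Kl T X X" "\<beta> \<in> Kl T Y Y"
    "kle T X Y (compose X \<beta> f) (compose X (Tmap T X Y f) \<alpha>)"
  shows "kle T X Y (compose X (sat T Y \<beta>) f) (compose X (Tmap T X Y f) (sat T X \<alpha>))"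
  using sat_oplax[of X Y f \<alpha> \<beta>] assms
  by (simp add: kcomp_sharp_left kcomp_sharp_right sat_hom)

text \<open>A saturated morphism is reflexive and transitive, so it is its own least
  saturation.\<close>

lemma sat_sat:
  assumes "X \<in> U" "\<alpha> \<in> Kl T X X"
  shows "sat T X (sat T X \<alpha>) = sat T X \<alpha>"
  using assms
  by (intro kle_antisym[of X X] sat_least sat_incl)
    (auto intro: sat_hom sat_refl sat_trans kle_refl)

text \<open>The homomorphism equation is a lax and an oplax inequality. Each passes to the
  saturations, and antisymmetry joins them again.\<close>

lemma coalg_hom_sat:
  assumes X: "X \<in> U" and Y: "Y \<in> U" and \<alpha>: "\<alpha> \<in> Kl T X X" and \<beta>: "\<beta> \<in> Kl T Y Y"
    and h: "coalg_hom T X \<alpha> Y \<beta> h"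
  shows "coalg_hom T X (sat T X \<alpha>) Y (sat T Y \<beta>) h"
proof -
  have hY: "h \<in> X \<rightarrow>\<^sub>E Y" and eq: "compose X (Tmap T X Y h) \<alpha> = compose X \<beta> h"
    using h by (auto simp: coalg_hom_def)
  have Kl: "compose X \<gamma> h \<in> Kl T X Y" if "\<gamma> \<in> Kl T Y Y" for \<gamma>
    using that unfolding Kl_def by (rule compose_PiE[OF hY])
  have Kl': "compose X (Tmap T X Y h) \<gamma> \<in> Kl T X Y" if "\<gamma> \<in> Kl T X X" for \<gamma>
    using that unfolding Kl_def by (rule compose_PiE[OF _ Tmap_hom[OF X Y hY]])
  have le: "kle T X Y (compose X \<beta> h) (compose X \<beta> h)" by (intro kle_refl X Y Kl \<beta>)
  have "compose X (Tmap T X Y h) (sat T X \<alpha>) = compose X (sat T Y \<beta>) h"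
    by (intro kle_antisym[OF X Y] Kl Kl' sat_hom sat_lax_Tmap sat_oplax_Tmap X Y \<alpha> \<beta> hY)
      (simp_all add: eq le)
  with hY show ?thesis by (simp add: coalg_hom_def)
qed

end

section \<open>Kernels and weak bisimulations\<close>

locale saturation_monad_universe = set_universe U pr + ordered_saturation_monad U T
  for U :: "'u set set" and pr :: "'u \<Rightarrow> 'u \<Rightarrow> 'u" and T :: "('u, 'm) saturation_data_scheme"
begin

lemma rel_ob_small:
  assumes "X \<in> U" "R \<subseteq> X \<times> X"
  shows "rel_ob pr R \<in> U"
proof (rule small_subset)
  show "(\<lambda>(a, b). pr a b) ` (SIGMA a:X. X) \<in> U" using assms by (intro small_product)
qed (use assms in \<open>auto simp: rel_ob_def\<close>)

lemma rel_ob_projections: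
  assumes "R \<subseteq> X \<times> X"
  shows "(\<lambda>p\<in>rel_ob pr R. pfst pr p) \<in> rel_ob pr R \<rightarrow>\<^sub>E X"
    and "(\<lambda>p\<in>rel_ob pr R. psnd pr p) \<in> rel_ob pr R \<rightarrow>\<^sub>E X"
  using assms by (auto simp: rel_ob_def)

lemma weak_bisimulation_iff:
  assumes X: "X \<in> U" and \<alpha>: "\<alpha> \<in> X \<rightarrow>\<^sub>E Tob T X"
  shows "weak_bisimulation pr T X \<alpha> R \<longleftrightarrow> R \<subseteq> X \<times> X \<and> sym R \<and>
     (let P = rel_ob pr R; p1 = (\<lambda>p\<in>P. pfst pr p); p2 = (\<lambda>p\<in>P. psnd pr p)
      in \<exists>\<gamma>\<in>P \<rightarrow>\<^sub>E Tob T P.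
           kle T P X (compose P \<alpha> p1) (compose P (Tmap T P X p1) \<gamma>) \<and>
           kle T P X (compose P (Tmap T P X p2) \<gamma>) (compose P (sat T X \<alpha>) p2))"
\<comment> \<open>Rewriting the composites with \<open>sharp\<close> requires
  \<open>rel_ob pr R\<close> to be small, which follows from
  \<open>R \<subseteq> X \<times> X\<close>; otherwise both sides are false.\<close>
proof (cases "R \<subseteq> X \<times> X")
  case True
  have "\<alpha> \<in> Kl T X X" using \<alpha> by (simp add: Kl_def)
  moreover have "\<gamma> \<in> Kl T P P" if "\<gamma> \<in> P \<rightarrow>\<^sub>E Tob T P" for \<gamma> P
    using that by (simp add: Kl_def)
  ultimately show ?thesis
    using True X rel_ob_small[OF X True] rel_ob_projections[OF True] sat_hom[OF X]
    unfolding weak_bisimulation_def Let_def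
    by (simp add: kcomp_sharp_right kcomp_sharp_left cong: bex_cong)
qed (simp add: weak_bisimulation_def)

lemma is_pullback_kernel:
  assumes X: "X \<in> U" and k: "k \<in> X \<rightarrow>\<^sub>E Z"
  defines "P \<equiv> rel_ob pr {(x, y). x \<in> X \<and> y \<in> X \<and> k x = k y}"
  shows "is_pullback U X X Z k k P (\<lambda>p\<in>P. pfst pr p) (\<lambda>p\<in>P. psnd pr p)"
proof -
  let ?R = "{(x, y). x \<in> X \<and> y \<in> X \<and> k x = k y}"
  let ?p1 = "\<lambda>p\<in>P. pfst pr p" and ?p2 = "\<lambda>p\<in>P. psnd pr p"
  have R: "?R \<subseteq> X \<times> X" by auto
  have P: "p \<in> P \<longleftrightarrow> (\<exists>x y. p = pr x y \<and> x \<in> X \<and> y \<in> X \<and> k x = k y)" for p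
    by (auto simp: P_def rel_ob_def)
  have "\<exists>!u. u \<in> W \<rightarrow>\<^sub>E P \<and> compose W ?p1 u = q1 \<and> compose W ?p2 u = q2"
    if q: "q1 \<in> W \<rightarrow>\<^sub>E X" "q2 \<in> W \<rightarrow>\<^sub>E X" and eq: "compose W k q1 = compose W k q2" for W q1 q2
  proof
    \<comment> \<open>The mediating map pairs \<open>q1\<close> and \<open>q2\<close>; it is unique
      because elements of \<open>P\<close> are determined by their two components.\<close>
    let ?u = "\<lambda>w\<in>W. pr (q1 w) (q2 w)"
    have inP: "pr (q1 w) (q2 w) \<in> P" if "w \<in> W" for w
      using that q fun_cong[OF eq, of w] by (auto simp: P compose_def)
    have "compose W ?p1 ?u = q1" "compose W ?p2 ?u = q2"
      using q inP by (auto simp: compose_def fun_eq_iff PiE_def extensional_def)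
    with inP show "?u \<in> W \<rightarrow>\<^sub>E P \<and> compose W ?p1 ?u = q1 \<and> compose W ?p2 ?u = q2" by auto
    fix u assume u: "u \<in> W \<rightarrow>\<^sub>E P \<and> compose W ?p1 u = q1 \<and> compose W ?p2 u = q2"
    show "u = ?u"
    proof
      fix w show "u w = ?u w"
      proof (cases "w \<in> W")
        case True
        then have uP: "u w \<in> P" using u by auto
        then obtain a b where ab: "u w = pr a b" by (auto simp: P)
        have "compose W ?p1 u w = a" "compose W ?p2 u w = b"
          using True uP ab by (auto simp: compose_def)
        then show ?thesis using u True ab by auto
      qed (use u in auto)
    qed
  qed
  moreover have "P \<in> U" using rel_ob_small[OF X R] by (simp add: P_def)
  moreover have "?p1 \<in> P \<rightarrow>\<^sub>E X" "?p2 \<in> P \<rightarrow>\<^sub>E X" "compose P k ?p1 = compose P k ?p2"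
    by (auto simp: P compose_def fun_eq_iff)
  ultimately show ?thesis unfolding is_pullback_def by blast
qed

lemma weak_bisimulation_kernel:
  assumes pb: "weakly_lax_preserves_pullbacks U T"
    and X: "X \<in> U" and Z: "Z \<in> U" and \<alpha>: "\<alpha> \<in> X \<rightarrow>\<^sub>E Tob T X"
    and k: "coalg_hom T X (sat T X \<alpha>) Z \<zeta> k"
  shows "weak_bisimulation pr T X \<alpha> {(x, y). x \<in> X \<and> y \<in> X \<and> k x = k y}"
proof -
  let ?R = "{(x, y). x \<in> X \<and> y \<in> X \<and> k x = k y}" and ?s = "sat T X \<alpha>"
  define P where "P = rel_ob pr ?R"
  define p1 where "p1 = (\<lambda>p\<in>P. pfst pr p)"
  define p2 where "p2 = (\<lambda>p\<in>P. psnd pr p)"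
  have kZ: "k \<in> X \<rightarrow>\<^sub>E Z" and keq: "compose X (Tmap T X Z k) ?s = compose X \<zeta> k"
    using k by (auto simp: coalg_hom_def)
  have \<alpha>K: "\<alpha> \<in> Kl T X X" using \<alpha> by (simp add: Kl_def)
  then have sK: "?s \<in> Kl T X X" by (rule sat_hom[OF X])
  have pull: "is_pullback U X X Z k k P p1 p2"
    using is_pullback_kernel[OF X kZ] by (simp add: P_def p1_def p2_def)
  then have P: "P \<in> U" and p: "p1 \<in> P \<rightarrow>\<^sub>E X" "p2 \<in> P \<rightarrow>\<^sub>E X"
    and kp: "compose P k p1 = compose P k p2"
    by (auto simp: is_pullback_def)
  have sp: "compose P ?s p' \<in> P \<rightarrow>\<^sub>E Tob T X" if "p' \<in> P \<rightarrow>\<^sub>E X" for p'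
    using that sK unfolding Kl_def by (rule compose_PiE)
  have "is_weak_pullback U (Tob T X) (Tob T X) (Tob T Z) (Tmap T X Z k) (Tmap T X Z k)
          (Tob T P) (Tmap T P X p1) (Tmap T P X p2)"
    using pb pull X Z kZ unfolding weakly_lax_preserves_pullbacks_def by blast
  \<comment> \<open>As \<open>k\<close> is a homomorphism, both sides equal \<zeta> after
    \<open>k\<close> after a projection, and \<open>k\<close> does not distinguish the
    projections.\<close>
  moreover have "compose P (Tmap T X Z k) (compose P ?s p1)
      = compose P (Tmap T X Z k) (compose P ?s p2)"
    using p kp by (simp add: compose_assoc_PiE keq) (simp flip: compose_assoc_PiE)
  ultimately obtain \<gamma> where \<gamma>: "\<gamma> \<in> P \<rightarrow>\<^sub>E Tob T P"
      "compose P (Tmap T P X p1) \<gamma> = compose P ?s p1"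
      "compose P (Tmap T P X p2) \<gamma> = compose P ?s p2"
    using P sp p unfolding is_weak_pullback_def by metis
  \<comment> \<open>The witness lies exactly over \<open>\<alpha>\<^sup>*\<close> along both
    projections. The first condition only asks for \<alpha>, so
    \<open>\<alpha> \<le> \<alpha>\<^sup>*\<close> suffices; the second holds with equality.\<close>
  have "kle T P X (compose P \<alpha> p1) (compose P (Tmap T P X p1) \<gamma>)"
    unfolding \<gamma> by (intro kle_compose_right[OF P X X] p \<alpha>K sK sat_incl X)
  moreover have "kle T P X (compose P (Tmap T P X p2) \<gamma>) (compose P ?s p2)"
    unfolding \<gamma> using sp p by (intro kle_refl P X) (simp add: Kl_def)
  moreover have "?R \<subseteq> X \<times> X" "sym ?R" by (auto simp: sym_def)
  ultimately show ?thesis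
    unfolding weak_bisimulation_iff[OF X \<alpha>] Let_def
    using \<gamma>(1) unfolding P_def p1_def p2_def by blast
qed

text \<open>This is the compatibility needed to put a coalgebra structure on a quotient of
  \<open>\<alpha>\<^sup>*\<close>. The saturated witness \<open>\<gamma>'\<close> is squeezed
  between \<open>\<alpha>\<^sup>*\<close> along the two projections, which \<open>q\<close>
  identifies.\<close>

lemma weak_bisimulation_Tmap_sat_eq:
  assumes X: "X \<in> U" and Q: "Q \<in> U" and \<alpha>: "\<alpha> \<in> X \<rightarrow>\<^sub>E Tob T X"
    and R: "weak_bisimulation pr T X \<alpha> R" and q: "q \<in> X \<rightarrow>\<^sub>E Q"
    and resp: "\<And>x y. (x, y) \<in> R \<Longrightarrow> q x = q y" and xy: "(x, y) \<in> R"
  shows "Tmap T X Q q (sat T X \<alpha> x) = Tmap T X Q q (sat T X \<alpha> y)"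
proof -
  let ?s = "sat T X \<alpha>"
  define P where "P = rel_ob pr R"
  define p1 where "p1 = (\<lambda>p\<in>P. pfst pr p)"
  define p2 where "p2 = (\<lambda>p\<in>P. psnd pr p)"
  have RX: "R \<subseteq> X \<times> X" and "sym R"
    using R by (auto simp: weak_bisimulation_def)
  have P: "P \<in> U" using rel_ob_small[OF X RX] by (simp add: P_def)
  have p: "p1 \<in> P \<rightarrow>\<^sub>E X" "p2 \<in> P \<rightarrow>\<^sub>E X"
    using rel_ob_projections[OF RX] by (simp_all add: P_def p1_def p2_def)
  obtain \<gamma> where \<gamma>: "\<gamma> \<in> P \<rightarrow>\<^sub>E Tob T P"
      "kle T P X (compose P \<alpha> p1) (compose P (Tmap T P X p1) \<gamma>)"
      "kle T P X (compose P (Tmap T P X p2) \<gamma>) (compose P ?s p2)"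
    using R unfolding weak_bisimulation_iff[OF X \<alpha>] Let_def P_def p1_def p2_def by blast
  have \<alpha>K: "\<alpha> \<in> Kl T X X" and \<gamma>K: "\<gamma> \<in> Kl T P P" using \<alpha> \<gamma> by (simp_all add: Kl_def)
  have sK: "?s \<in> Kl T X X" by (rule sat_hom[OF X \<alpha>K])
  define \<gamma>' where "\<gamma>' = sat T P \<gamma>"
  have \<gamma>'K: "\<gamma>' \<in> Kl T P P" unfolding \<gamma>'_def by (rule sat_hom[OF P \<gamma>K])
  have le1: "kle T P X (compose P ?s p1) (compose P (Tmap T P X p1) \<gamma>')"
    unfolding \<gamma>'_def by (intro sat_oplax_Tmap P X p \<alpha>K \<gamma>K \<gamma>)
  \<comment> \<open>The right side of the second condition is already saturated; saturating again
    gives \<open>\<alpha>\<^sup>*\<^sup>*\<close>, which \<open>sat_sat\<close> collapses.\<close>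
  have le2: "kle T P X (compose P (Tmap T P X p2) \<gamma>') (compose P ?s p2)"
    using sat_lax_Tmap[OF P X p(2) \<gamma>K sK \<gamma>(3)] by (simp add: \<gamma>'_def sat_sat[OF X \<alpha>K])
  have sp: "compose P ?s p' \<in> Kl T P X" if "p' \<in> P \<rightarrow>\<^sub>E X" for p'
    using that sK unfolding Kl_def by (rule compose_PiE)
  have Tp: "compose P (Tmap T P X p') \<gamma>' \<in> Kl T P X" if "p' \<in> P \<rightarrow>\<^sub>E X" for p'
    using \<gamma>'K unfolding Kl_def by (rule compose_PiE[OF _ Tmap_hom[OF P X that]])
  have Tq: "compose P (Tmap T X Q q) f \<in> Kl T P Q" if "f \<in> Kl T P X" for f
    using that unfolding Kl_def by (rule compose_PiE[OF _ Tmap_hom[OF X Q q]])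
  have "compose P q p1 = compose P q p2"
    using resp by (auto simp: compose_def fun_eq_iff p1_def p2_def P_def rel_ob_def)
  \<comment> \<open>By functoriality both sides are \<open>T(q \<circ> p)\<close> after
    \<open>\<gamma>'\<close>, for \<open>p\<close> one of the two projections.\<close>
  then have mid: "compose P (Tmap T X Q q) (compose P (Tmap T P X p1) \<gamma>')
      = compose P (Tmap T X Q q) (compose P (Tmap T P X p2) \<gamma>')"
    using \<gamma>'K P X Q p q by (simp add: Kl_def compose_assoc_PiE flip: Tmap_compose)
  define a1 where "a1 = compose P (Tmap T X Q q) (compose P ?s p1)"
  define a2 where "a2 = compose P (Tmap T X Q q) (compose P ?s p2)"
  have aK: "a1 \<in> Kl T P Q" "a2 \<in> Kl T P Q" unfolding a1_def a2_def by (intro Tq sp p)+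
  have le: "kle T P Q a1 a2"
    using kle_Tmap_left[OF P X Q q sp[OF p(1)] Tp[OF p(1)] le1]
      kle_Tmap_left[OF P X Q q Tp[OF p(2)] sp[OF p(2)] le2]
      kle_trans[OF P Q aK(1) Tq[OF Tp[OF p(2)]] aK(2)]
    unfolding mid a1_def a2_def by blast
  \<comment> \<open>The order compares whole morphisms, not values, so the reverse inequality comes
    from precomposing with the exchange of coordinates, which interchanges \<open>a1\<close> and
    \<open>a2\<close>.\<close>
  define swap where "swap = (\<lambda>p\<in>P. pr (psnd pr p) (pfst pr p))"
  have swap: "swap \<in> P \<rightarrow>\<^sub>E P"
    using \<open>sym R\<close> by (auto simp: swap_def P_def rel_ob_def sym_def)
  have "compose P a1 swap = a2" "compose P a2 swap = a1"
    using swap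
    by (auto simp: a1_def a2_def swap_def p1_def p2_def compose_def fun_eq_iff)
  then have "kle T P Q a2 a1" using kle_compose_right[OF P P Q swap aK le] by simp
  then have "a1 (pr x y) = a2 (pr x y)" using kle_antisym[OF P Q aK le] by simp
  moreover have "pr x y \<in> P" using xy by (force simp: P_def rel_ob_def)
  ultimately show ?thesis
    by (simp add: a1_def a2_def p1_def p2_def compose_def)
qed

lemma weak_bisimulation_imp_kernel:
  assumes final: "final_coalgebra U T Z \<zeta>" and X: "X \<in> U" and \<alpha>: "\<alpha> \<in> X \<rightarrow>\<^sub>E Tob T X"
    and R: "weak_bisimulation pr T X \<alpha> R" and k: "coalg_hom T X (sat T X \<alpha>) Z \<zeta> k"
    and xy: "(x, y) \<in> R"
  shows "k x = k y"
proof -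
  have RX: "R \<subseteq> X \<times> X" and "sym R"
    using R by (auto simp: weak_bisimulation_def)
  \<comment> \<open>Because \<open>R\<close> is symmetric, its reflexive transitive closure is the
    equivalence relation it generates.\<close>
  have sym: "(b, a) \<in> R\<^sup>*" if "(a, b) \<in> R\<^sup>*" for a b
    using sym_rtrancl[OF \<open>sym R\<close>] that by (rule symD)
  define q where "q = (\<lambda>a\<in>X. SOME b. (a, b) \<in> R\<^sup>*)"
  define Q where "Q = q ` X"
  have q_rel: "(a, q a) \<in> R\<^sup>*" if "a \<in> X" for a
    using that someI[of "\<lambda>b. (a, b) \<in> R\<^sup>*" a] by (simp add: q_def)
  have in_X: "b \<in> X" if "(a, b) \<in> R\<^sup>*" "a \<in> X" for a b
    using that RX by (induction rule: rtrancl_induct) auto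
  have q_resp: "q a = q b" if "(a, b) \<in> R" for a b
  proof -
    \<comment> \<open>Related elements define the same predicate under \<open>SOME\<close>, hence
      get the same representative.\<close>
    have "(a, c) \<in> R\<^sup>* \<longleftrightarrow> (b, c) \<in> R\<^sup>*" for c
      using that sym[OF r_into_rtrancl[OF that]] by (meson converse_rtrancl_into_rtrancl rtrancl_trans)
    moreover have "a \<in> X" "b \<in> X" using that RX by auto
    ultimately show ?thesis by (simp add: q_def)
  qed
  have QX: "Q \<subseteq> X" using q_rel in_X by (auto simp: Q_def)
  then have Q: "Q \<in> U" by (rule small_subset[OF X])
  have q: "q \<in> X \<rightarrow>\<^sub>E Q" by (auto simp: Q_def q_def)
  \<comment> \<open>Equality propagates along chains of \<open>R\<close>, in particular from an
    element to its representative.\<close>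
  have "Tmap T X Q q (sat T X \<alpha> a) = Tmap T X Q q (sat T X \<alpha> b)" if "(a, b) \<in> R\<^sup>*" for a b
    using that
    by (induction rule: rtrancl_induct)
      (simp_all add: weak_bisimulation_Tmap_sat_eq[OF X Q \<alpha> R q q_resp])
  then have rep: "Tmap T X Q q (sat T X \<alpha> (q a)) = Tmap T X Q q (sat T X \<alpha> a)" if "a \<in> X" for a
    using q_rel[OF that] by metis
  have s: "sat T X \<alpha> \<in> X \<rightarrow>\<^sub>E Tob T X" using sat_hom[OF X] \<alpha> by (simp add: Kl_def)
  show ?thesis
    using xy RX by (intro coalg_hom_final_respects[OF final X s Q QX q rep k] q_resp) auto
qed

text \<open>The kernel is a weak bisimulation containing all others, so the description by
  \<open>GREATEST\<close> is attained, and attained there.\<close>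

lemma weak_bisimilarity_eq_kernel:
  assumes "weakly_lax_preserves_pullbacks U T" and final: "final_coalgebra U T Z \<zeta>"
    and X: "X \<in> U" and \<alpha>: "\<alpha> \<in> X \<rightarrow>\<^sub>E Tob T X" and k: "coalg_hom T X (sat T X \<alpha>) Z \<zeta> k"
  shows "weak_bisimilarity pr T X \<alpha> = {(x, y). x \<in> X \<and> y \<in> X \<and> k x = k y}"
  unfolding weak_bisimilarity_def
proof (rule Greatest_equality)
  have "Z \<in> U" using final by (simp add: final_coalgebra_def)
  with assms show "weak_bisimulation pr T X \<alpha> {(x, y). x \<in> X \<and> y \<in> X \<and> k x = k y}"
    by (intro weak_bisimulation_kernel)
next
  fix R assume R: "weak_bisimulation pr T X \<alpha> R"
  then have "R \<subseteq> X \<times> X" by (simp add: weak_bisimulation_def)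
  then show "R \<subseteq> {(x, y). x \<in> X \<and> y \<in> X \<and> k x = k y}"
    using weak_bisimulation_imp_kernel[OF final X \<alpha> R k] by auto
qed

end

theorem theorem6p10:
  fixes U :: "'u set set" and pr :: "'u \<Rightarrow> 'u \<Rightarrow> 'u" and T :: "'u saturation_data"
    and Z X :: "'u set" and \<zeta> \<alpha> :: "'u \<Rightarrow> 'u" and x y :: 'u
  assumes "set_universe U pr"
    and "ordered_saturation_monad U T"
    and "cotupling_monotonic U pr T"
    and "weakly_lax_preserves_pullbacks U T"
    and "final_coalgebra U T Z \<zeta>"
    and "X \<in> U" and "\<alpha> \<in> X \<rightarrow>\<^sub>E Tob T X"
    and "x \<in> X" and "y \<in> X"
  shows "(x, y) \<in> weak_bisimilarity pr T X \<alpha> \<longleftrightarrow>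
    beh T Z \<zeta> Z (sat T Z \<zeta>) (beh T Z \<zeta> X \<alpha> x) = beh T Z \<zeta> Z (sat T Z \<zeta>) (beh T Z \<zeta> X \<alpha> y)"
proof -
  interpret set_universe U pr by fact
  interpret ordered_saturation_monad U T by fact
  interpret saturation_monad_universe U pr T ..
  note final = assms(5) and X = assms(6) and \<alpha> = assms(7)
  have Z: "Z \<in> U" and \<zeta>: "\<zeta> \<in> Kl T Z Z" using final by (simp_all add: final_coalgebra_def Kl_def)
  have \<alpha>K: "\<alpha> \<in> Kl T X X" using \<alpha> by (simp add: Kl_def)
  have s: "sat T X \<alpha> \<in> X \<rightarrow>\<^sub>E Tob T X" "sat T Z \<zeta> \<in> Z \<rightarrow>\<^sub>E Tob T Z"
    using sat_hom[OF X \<alpha>K] sat_hom[OF Z \<zeta>] by (simp_all add: Kl_def)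
  \<comment> \<open>The target here is \<open>\<zeta>\<^sup>*\<close>, not \<zeta>; the outer
    \<open>beh\<close> then leads from \<open>\<zeta>\<^sup>*\<close> back to \<zeta>.\<close>
  have "coalg_hom T X (sat T X \<alpha>) Z (sat T Z \<zeta>) (beh T Z \<zeta> X \<alpha>)"
    by (intro coalg_hom_sat X Z \<alpha>K \<zeta> coalg_hom_beh final \<alpha>)
  from coalg_hom_compose[OF X Z Z s(1) this coalg_hom_beh[OF final Z s(2)]]
  have "coalg_hom T X (sat T X \<alpha>) Z \<zeta>
      (compose X (beh T Z \<zeta> Z (sat T Z \<zeta>)) (beh T Z \<zeta> X \<alpha>))" .
  from weak_bisimilarity_eq_kernel[OF assms(4) final X \<alpha> this]
  show ?thesis using \<open>x \<in> X\<close> \<open>y \<in> X\<close> by (simp add: compose_def)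
qed

end
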